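(* Let $n\in\mathbb{N}$, $1\le p<n$, $p^*=\frac{np}{n-p}$, and let $Q_0\subset\mathbb{R}^n$ be a cube with $|Q_0|=1$. Then there is a constant $C$ depending only on $n$ and $p$ such that for every $f\in L^1(Q_0)$ $$\|f-f_{Q_0}\|_{L^{p^*,\infty}(Q_0)}\le C\,\|f\|_{\mathcal{O}^p(Q_0)}.$$
   Context: All integrals are with respect to Lebesgue measure. For a cube $Q$, $\ell(Q)$ is its sidelength, $|Q|$ its Lebesgue measure, $f_Q=\frac1{|Q|}\int_Q f$, and $O(f,Q)=\frac1{|Q|}\int_Q|f-f_Q|$ is the mean oscillation. $\mathcal{D}(Q_0)$ denotes the collection of dyadic subcubes of $Q_0$, i.e. the cubes obtained by repeatedly bisecting the sides of $Q_0$ (including $Q_0$ itself). Define $$\|f\|_{\mathcal{O}^p(Q_0)}=\Big(\sup_{\lambda>0}\lambda^p\sum_{Q\in\mathcal{D}(Q_0),\ O(f,Q)>\lambda}\ell(Q)^{-p}|Q|\Big)^{1/p}\in[0,\infty],$$ and, for a measurable function $g$ on $Q_0$, $\|g\|_{L^{q,\infty}(Q_0)}=\big(\sup_{\lambda>0}\lambda^q|\{x\in Q_0:|g(x)|>\lambda\}|\big)^{1/q}$. *)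

theory Defs
  imports "HOL-Analysis.Analysis"
begin

text \<open>Cubes are closed, nondegenerate and have sides parallel to the coordinate axes.\<close>

definition cube :: "real ^ 'n \<Rightarrow> real \<Rightarrow> (real ^ 'n) set" where
  "cube a l = cbox a (a + vec l)"

definition is_cube :: "(real ^ 'n) set \<Rightarrow> bool" where
  "is_cube Q \<longleftrightarrow> (\<exists>a l. 0 < l \<and> Q = cube a l)"

definition sidelength :: "(real ^ 'n) set \<Rightarrow> real" where
  "sidelength Q = (THE l. 0 < l \<and> (\<exists>a. Q = cube a l))"

lemma sidelength_cube:
  assumes "0 < l"
  shows "sidelength (cube a l) = l"
  unfolding sidelength_def
proof (rule the_equality)
  show "0 < l \<and> (\<exists>b. cube a l = cube b l)"
    using assms by blast
next
  fix m assume "0 < m \<and> (\<exists>b. cube a l = cube b m)"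
  then obtain b where m: "0 < m" and eq: "cube a l = cube b m" by blast
  have "cbox a (a + vec l) \<noteq> {}"
    using assms by (simp add: interval_ne_empty_cart)
  then have "a = b" "a + vec l = b + vec m"
    using eq by (auto simp: cube_def eq_cbox)
  then show "m = l"
    by (metis add_left_cancel vec_component)
qed

text \<open>Each step bisects every side, so a cube has one child for each choice, in every
  coordinate, of the lower or the upper half of the side. The cubes being closed, two cubes
  of the same generation may share boundary points, which is a null set.\<close>

inductive_set dyadic_subcubes :: "(real ^ 'n) set \<Rightarrow> (real ^ 'n) set set"
  for Q0 :: "(real ^ 'n) set" where
  self: "Q0 \<in> dyadic_subcubes Q0"
| bisect: "cube b (l / 2) \<in> dyadic_subcubes Q0"
    if "cube a l \<in> dyadic_subcubes Q0" and "0 < l"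
      and "\<And>i. b $ i = a $ i \<or> b $ i = a $ i + l / 2"

definition average :: "(real ^ 'n \<Rightarrow> real) \<Rightarrow> (real ^ 'n) set \<Rightarrow> real" where
  "average f Q = (1 / measure lebesgue Q) * (LINT x:Q|lebesgue. f x)"

definition mean_osc :: "(real ^ 'n \<Rightarrow> real) \<Rightarrow> (real ^ 'n) set \<Rightarrow> real" where
  "mean_osc f Q =
     (1 / measure lebesgue Q) * (LINT x:Q|lebesgue. \<bar>f x - average f Q\<bar>)"

text \<open>Powers of extended nonnegative reals with exponent \<open>r > 0\<close>, with the convention
  \<open>\<infinity>\<^sup>r = \<infinity>\<close>.\<close>

definition ennreal_powr :: "ennreal \<Rightarrow> real \<Rightarrow> ennreal" where
  "ennreal_powr x r = (if x = \<infinity> then \<infinity> else ennreal (enn2real x powr r))"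

definition osc_norm :: "real \<Rightarrow> (real ^ 'n) set \<Rightarrow> (real ^ 'n \<Rightarrow> real) \<Rightarrow> ennreal" where
  "osc_norm p Q0 f = ennreal_powr
     (SUP t\<in>{0<..}. ennreal (t powr p) *
        (\<Sum>\<^sub>\<infinity>Q\<in>{Q \<in> dyadic_subcubes Q0. mean_osc f Q > t}.
           ennreal (sidelength Q powr (- p) * measure lebesgue Q)))
     (1 / p)"

definition weak_Lp_norm :: "real \<Rightarrow> (real ^ 'n) set \<Rightarrow> (real ^ 'n \<Rightarrow> real) \<Rightarrow> ennreal" where
  "weak_Lp_norm q Q0 g = ennreal_powr
     (SUP t\<in>{0<..}. ennreal (t powr q) * emeasure lebesgue {x \<in> Q0. \<bar>g x\<bar> > t})
     (1 / q)"

end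

theory Submission
  imports Defs
begin

text \<open>
  Write \<open>S = N\<^sup>p\<close> with \<open>N\<close> the norm on the right, and call a dyadic cube \<open>Q\<close> of side
  \<open>2\<^sup>-\<^sup>k\<close> bad when its oscillation exceeds a threshold \<open>s\<^sub>k\<close>. The norm bounds the total measure
  of the bad cubes of generation \<open>k\<close> by \<open>S s\<^sub>k\<^sup>-\<^sup>p 2\<^sup>-\<^sup>k\<^sup>p\<close>; since their number is an integer, there
  are none once this drops below the measure of a single cube. Consecutive averages along a chain
  of dyadic cubes differ by at most \<open>2\<^sup>n\<close> times the oscillation, so a point avoiding all bad
  cubes of generations \<open>k < m\<close> lies in a cube of generation \<open>m\<close> whose average is within
  \<open>2\<^sup>n \<Sum>k<m. s\<^sub>k\<close> of that of \<open>Q\<^sub>0\<close>. The deviation of \<open>f\<close> from its averages over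
  generation \<open>m\<close> tends to 0 in measure, again by the count of bad cubes together with Markov's
  inequality, so no differentiation theorem is needed. Choosing \<open>s\<^sub>k\<close> growing up to a critical
  generation, with no bad cubes there, and decaying like \<open>2\<^sup>-\<^sup>k\<^sup>/\<^sup>2\<close> afterwards gives the weak-type
  bound.
\<close>

section \<open>Dyadic corners: finiteness and counting\<close>

text \<open>Lower corners of the dyadic subcubes of side \<open>(1/2) ^ k\<close> of \<open>cube a 1\<close>.\<close>

primrec corners :: "real ^ 'n \<Rightarrow> nat \<Rightarrow> (real ^ 'n) set" where
  "corners a 0 = {a}"
| "corners a (Suc k) =
     (\<Union>b\<in>corners a k. {c. \<forall>i. c $ i = b $ i \<or> c $ i = b $ i + (1/2) ^ Suc k})"

text \<open>A child is determined by the set of coordinates in which it takes the upper half of the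
  side, so the subsets of the index type account for all children.\<close>

lemma finite_card_children:
  fixes b :: "real ^ 'n::finite"
  shows "finite {c. \<forall>i. c $ i = b $ i \<or> c $ i = b $ i + h}"
    and "card {c. \<forall>i. c $ i = b $ i \<or> c $ i = b $ i + h} \<le> 2 ^ CARD('n)"
proof -
  let ?g = "\<lambda>S :: 'n set. \<chi> i. if i \<in> S then b $ i + h else b $ i"
  have sub: "{c. \<forall>i. c $ i = b $ i \<or> c $ i = b $ i + h} \<subseteq> ?g ` UNIV"
  proof
    fix c assume c: "c \<in> {c. \<forall>i. c $ i = b $ i \<or> c $ i = b $ i + h}"
    then have "c = ?g {i. c $ i = b $ i + h}"
      by (auto simp: vec_eq_iff)
    then show "c \<in> ?g ` UNIV" by blast
  qed
  then show "finite {c. \<forall>i. c $ i = b $ i \<or> c $ i = b $ i + h}"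
    by (rule finite_subset) simp
  have "card {c. \<forall>i. c $ i = b $ i \<or> c $ i = b $ i + h} \<le> card (?g ` UNIV)"
    by (rule card_mono[OF _ sub]) simp
  also have "\<dots> \<le> card (UNIV :: 'n set set)"
    by (rule card_image_le) simp
  also have "\<dots> = 2 ^ CARD('n)"
    by (simp flip: Pow_UNIV add: card_Pow)
  finally show "card {c. \<forall>i. c $ i = b $ i \<or> c $ i = b $ i + h} \<le> 2 ^ CARD('n)" .
qed

lemma finite_corners: "finite (corners (a :: real ^ 'n::finite) k)"
  by (induction k) (auto intro: finite_card_children(1))

text \<open>As a cube of generation \<open>k\<close> has measure
  \<open>((1/2) ^ k) ^ CARD('n)\<close>, this bounds the total measure of a generation by 1.\<close>

lemma card_corners: "card (corners (a :: real ^ 'n::finite) k) \<le> (2 ^ CARD('n)) ^ k"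
proof (induction k)
  case (Suc k)
  have "card (corners a (Suc k)) \<le>
    (\<Sum>b\<in>corners a k. card {c. \<forall>i. c $ i = b $ i \<or> c $ i = b $ i + (1/2) ^ Suc k})"
    unfolding corners.simps by (rule card_UN_le[OF finite_corners])
  also have "\<dots> \<le> (\<Sum>b\<in>corners a k. 2 ^ CARD('n))"
    by (intro sum_mono finite_card_children(2))
  also have "\<dots> \<le> (2 ^ CARD('n)) ^ Suc k"
    using Suc by simp
  finally show ?case .
qed simp

section \<open>Geometry of cubes and their children\<close>

lemma mem_cube: "x \<in> cube a l \<longleftrightarrow> (\<forall>i. a $ i \<le> x $ i \<and> x $ i \<le> a $ i + l)"
  by (simp add: cube_def mem_box_cart)

lemma cube_measurable [measurable, simp]: "cube a l \<in> sets lebesgue"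
  by (simp add: cube_def)

lemma cube_lmeasurable [simp]: "cube a l \<in> lmeasurable"
  by (simp add: cube_def)

lemma measure_cube:
  assumes "0 \<le> l"
  shows "measure lebesgue (cube (a :: real ^ 'n::finite) l) = l ^ CARD('n)"
proof -
  have "measure lebesgue (cube a l) = (\<Prod>i\<in>(UNIV :: 'n set). (a + vec l) $ i - a $ i)"
    unfolding cube_def
    using assms by (simp add: content_cbox_cart interval_ne_empty_cart)
  then show ?thesis by simp
qed

lemma inj_cube:
  fixes a b :: "real ^ 'n::finite"
  assumes "0 < l" "cube a l = cube b l"
  shows "a = b"
proof -
  have "cbox a (a + vec l) \<noteq> {}"
    using assms by (simp add: interval_ne_empty_cart)
  then show ?thesis
    using assms(2) by (auto simp: cube_def eq_cbox)
qed

lemma child_cube_subset: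
  assumes "\<And>i. c $ i = b $ i \<or> c $ i = b $ i + l / 2" and "0 \<le> l"
  shows "cube c (l / 2) \<subseteq> cube b l"
proof
  fix x assume x: "x \<in> cube c (l / 2)"
  show "x \<in> cube b l"
    unfolding mem_cube
  proof
    fix i
    show "b $ i \<le> x $ i \<and> x $ i \<le> b $ i + l"
      using x[unfolded mem_cube, rule_format, of i] assms(1)[of i] assms(2) by auto
  qed
qed

lemma dyadic_corners:
  "b \<in> corners a k \<Longrightarrow> cube b ((1/2) ^ k) \<in> dyadic_subcubes (cube a 1)"
proof (induction k arbitrary: b)
  case 0
  then show ?case by (simp add: dyadic_subcubes.self)
next
  case (Suc k)
  then obtain b' where "b' \<in> corners a k"
    and b: "\<And>i. b $ i = b' $ i \<or> b $ i = b' $ i + (1/2) ^ Suc k" by auto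
  with Suc.IH have "cube b' ((1/2) ^ k) \<in> dyadic_subcubes (cube a 1)" by blast
  from dyadic_subcubes.bisect[OF this, of b] b show ?case by simp
qed

lemma corners_subset: "b \<in> corners a k \<Longrightarrow> cube b ((1/2) ^ k) \<subseteq> cube a 1"
proof (induction k arbitrary: b)
  case (Suc k)
  then obtain b' where b': "b' \<in> corners a k"
    and b: "\<And>i. b $ i = b' $ i \<or> b $ i = b' $ i + (1/2) ^ Suc k" by auto
  have "cube b ((1/2) ^ k / 2) \<subseteq> cube b' ((1/2) ^ k)"
    using b by (intro child_cube_subset) auto
  with Suc.IH[OF b'] show ?case by simp
qed simp

lemma child_exists:
  assumes "b \<in> corners a k" and "x \<in> cube b ((1/2) ^ k)"
  obtains c where "c \<in> corners a (Suc k)" "x \<in> cube c ((1/2) ^ Suc k)"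
    "cube c ((1/2) ^ Suc k) \<subseteq> cube b ((1/2) ^ k)"
proof -
  define h :: real where "h = (1/2) ^ Suc k"
  have k: "(1/2) ^ k = 2 * h" by (simp add: h_def)
  \<comment> \<open>Comparison with the midpoint of each side selects a half containing
    \<open>x\<close>; a coordinate equal to the midpoint is sent to the lower half, which is
    closed.\<close>
  define c where "c = (\<chi> i. if x $ i \<le> b $ i + h then b $ i else b $ i + h)"
  have c: "c $ i = b $ i \<or> c $ i = b $ i + h" for i by (simp add: c_def)
  have "x \<in> cube c h"
    unfolding mem_cube
  proof
    fix i
    show "c $ i \<le> x $ i \<and> x $ i \<le> c $ i + h"
      using assms(2)[unfolded mem_cube k, rule_format, of i] by (auto simp: c_def)
  qed
  moreover have "c \<in> corners a (Suc k)"
    using assms(1) c unfolding h_def by auto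
  moreover have "cube c h \<subseteq> cube b ((1/2) ^ k)"
    using child_cube_subset[of c b "2 * h"] c unfolding k by (simp add: h_def)
  ultimately show ?thesis using that unfolding h_def by blast
qed

section \<open>Averages and oscillation on a cube\<close>

lemma set_integrable_cube_diff_const:
  fixes f :: "real ^ 'n::finite \<Rightarrow> real"
  assumes "set_integrable lebesgue (cube a 1) f" "cube b l \<subseteq> cube a 1"
  shows "set_integrable lebesgue (cube b l) (\<lambda>x. f x - c)"
proof -
  have "set_integrable lebesgue (cube b l) f"
    by (rule set_integrable_subset[OF assms(1) _ assms(2)]) simp
  moreover have "set_integrable lebesgue (cube b l) (\<lambda>x. c)"
    unfolding set_integrable_def
    by (intro integrable_scaleR_left integrable_real_indicator)
       (auto simp: cube_def emeasure_lborel_cbox_eq)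
  ultimately show ?thesis by (rule set_integral_diff(1))
qed

lemma integral_abs_average:
  assumes "0 < l"
  shows "(LINT x:cube b l|lebesgue. \<bar>f x - average f (cube b l)\<bar>) =
    l ^ CARD('n) * mean_osc f (cube (b :: real ^ 'n::finite) l)"
  using assms by (simp add: mean_osc_def measure_cube)

text \<open>With \<open>A\<close> the average of the parent, the integral of
  \<open>\<bar>f x - A\<bar>\<close> over the child is at most that over the parent; dividing by the
  measure of the child loses the ratio \<open>2 ^ CARD('n)\<close> of the two measures.\<close>

lemma average_diff_le:
  fixes f :: "real ^ 'n::finite \<Rightarrow> real"
  assumes f: "set_integrable lebesgue (cube a 1) f" and l: "0 < l"
    and sub: "cube c (l / 2) \<subseteq> cube b l" "cube b l \<subseteq> cube a 1"
  shows "\<bar>average f (cube c (l / 2)) - average f (cube b l)\<bar>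
    \<le> 2 ^ CARD('n) * mean_osc f (cube b l)"
proof -
  let ?n = "CARD('n)" and ?Q = "cube c (l / 2)"
  define A where "A = average f (cube b l)"
  have sQ: "?Q \<subseteq> cube a 1" using sub by blast
  have i: "set_integrable lebesgue ?Q (\<lambda>x. f x - A)"
    by (rule set_integrable_cube_diff_const[OF f sQ])
  have fQ: "set_integrable lebesgue ?Q f"
    using set_integrable_cube_diff_const[OF f sQ, of 0] by simp
  \<comment> \<open>The constant is obtained as \<open>f x - (f x - A)\<close>, a difference of
    integrable functions.\<close>
  have cQ: "set_integrable lebesgue ?Q (\<lambda>x. A)"
    using set_integral_diff(1)[OF fQ i] by simp
  have m: "measure lebesgue ?Q = (l / 2) ^ ?n" using l by (simp add: measure_cube)
  have "(LINT x:?Q|lebesgue. f x - A) = (LINT x:?Q|lebesgue. f x) - (l / 2) ^ ?n * A"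
    using set_integral_diff(2)[OF fQ cQ] m
    by (simp add: set_lebesgue_integral_def)
  then have eq: "(l / 2) ^ ?n * (average f ?Q - A) = (LINT x:?Q|lebesgue. f x - A)"
    using l by (simp add: average_def m right_diff_distrib)
  have "(l / 2) ^ ?n * \<bar>average f ?Q - A\<bar> = \<bar>LINT x:?Q|lebesgue. f x - A\<bar>"
    using l by (simp flip: eq add: abs_mult)
  also have "\<dots> \<le> (LINT x:?Q|lebesgue. \<bar>f x - A\<bar>)"
    using set_integral_norm_bound[OF i] by simp
  also have "\<dots> \<le> (LINT x:cube b l|lebesgue. \<bar>f x - A\<bar>)"
    unfolding set_lebesgue_integral_def
  proof (rule integral_mono)
    show "integrable lebesgue (\<lambda>x. indicator ?Q x *\<^sub>R \<bar>f x - A\<bar>)"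
      using set_integrable_abs[OF i] unfolding set_integrable_def .
    show "integrable lebesgue (\<lambda>x. indicator (cube b l) x *\<^sub>R \<bar>f x - A\<bar>)"
      using set_integrable_abs[OF set_integrable_cube_diff_const[OF f sub(2)]]
      unfolding set_integrable_def .
  qed (use sub in \<open>auto simp: indicator_def\<close>)
  also have "\<dots> = l ^ ?n * mean_osc f (cube b l)"
    unfolding A_def by (rule integral_abs_average[OF l])
  finally have "l ^ ?n * \<bar>average f ?Q - A\<bar> \<le> l ^ ?n * (2 ^ ?n * mean_osc f (cube b l))"
    by (simp add: power_divide pos_divide_le_eq mult_ac)
  then show ?thesis
    using l by (simp add: A_def)
qed

section \<open>Bad cubes and chains of averages\<close>

definition bad :: "(real ^ 'n \<Rightarrow> real) \<Rightarrow> real ^ 'n \<Rightarrow> nat \<Rightarrow> real \<Rightarrow> (real ^ 'n) set" where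
  "bad f a k s = {b \<in> corners a k. mean_osc f (cube b ((1/2) ^ k)) > s}"

lemma finite_bad: "finite (bad f (a :: real ^ 'n::finite) k s)"
  by (simp add: bad_def finite_corners)

text \<open>From the current cube pass to any child containing \<open>x\<close>. The current cube
  contains \<open>x\<close> and so is not bad, hence by \<open>average_diff_le\<close> the step
  costs at most \<open>2 ^ CARD('n) * s m\<close>, and the costs add up.\<close>

lemma chain_average:
  fixes f :: "real ^ 'n::finite \<Rightarrow> real" and s :: "nat \<Rightarrow> real"
  assumes f: "set_integrable lebesgue (cube a 1) f" and x: "x \<in> cube a 1"
    and good: "\<And>k b. k < m \<Longrightarrow> b \<in> bad f a k (s k) \<Longrightarrow> x \<notin> cube b ((1/2) ^ k)"
  shows "\<exists>b\<in>corners a m. x \<in> cube b ((1/2) ^ m) \<and>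
    \<bar>average f (cube b ((1/2) ^ m)) - average f (cube a 1)\<bar> \<le> 2 ^ CARD('n) * (\<Sum>k<m. s k)"
  using good
proof (induction m)
  case 0
  then show ?case using x by simp
next
  case (Suc m)
  then obtain b where b: "b \<in> corners a m" "x \<in> cube b ((1/2) ^ m)"
    and avg: "\<bar>average f (cube b ((1/2) ^ m)) - average f (cube a 1)\<bar>
      \<le> 2 ^ CARD('n) * (\<Sum>k<m. s k)"
    by (auto simp: less_Suc_eq)
  from b obtain c where c: "c \<in> corners a (Suc m)" "x \<in> cube c ((1/2) ^ Suc m)"
    "cube c ((1/2) ^ Suc m) \<subseteq> cube b ((1/2) ^ m)" by (rule child_exists)
  have "mean_osc f (cube b ((1/2) ^ m)) \<le> s m"
    using Suc.prems[of m b] b by (force simp: bad_def not_less)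
  then have "2 ^ CARD('n) * mean_osc f (cube b ((1/2) ^ m)) \<le> 2 ^ CARD('n) * s m"
    by simp
  moreover have "\<bar>average f (cube c ((1/2) ^ Suc m)) - average f (cube b ((1/2) ^ m))\<bar>
      \<le> 2 ^ CARD('n) * mean_osc f (cube b ((1/2) ^ m))"
    using average_diff_le[OF f, of "(1/2) ^ m" c b] c corners_subset[OF b(1)] by simp
  ultimately have "\<bar>average f (cube c ((1/2) ^ Suc m)) - average f (cube a 1)\<bar>
      \<le> 2 ^ CARD('n) * (\<Sum>k<Suc m. s k)"
    using avg unfolding sum.lessThan_Suc distrib_left by linarith
  with c show ?case by blast
qed

lemma superlevel_lmeasurable:
  fixes f :: "real ^ 'n::finite \<Rightarrow> real"
  assumes f: "set_integrable lebesgue (cube a 1) f" and sub: "cube b l \<subseteq> cube a 1"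
  shows "{x \<in> cube b l. \<bar>f x - c\<bar> > s} \<in> lmeasurable"
proof -
  have "set_integrable lebesgue (cube b l) (\<lambda>x. f x - c)"
    by (rule set_integrable_cube_diff_const[OF f sub])
  then have [measurable]: "(\<lambda>x. indicator (cube b l) x *\<^sub>R (f x - c)) \<in> borel_measurable lebesgue"
    unfolding set_integrable_def by simp
  \<comment> \<open>Only the function cut off outside the cube is known to be measurable on the
    whole space, so the set is rewritten in terms of it.\<close>
  have "{x \<in> cube b l. \<bar>f x - c\<bar> > s} =
    {x \<in> space lebesgue. x \<in> cube b l \<and> \<bar>indicator (cube b l) x *\<^sub>R (f x - c)\<bar> > s}"
    by (auto simp: indicator_def)
  also have "\<dots> \<in> sets lebesgue" by measurable
  finally show ?thesis
    by (rule fmeasurableI2[OF cube_lmeasurable[of b l], rotated]) auto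
qed

text \<open>Markov's inequality, the integral of the deviation being the measure of the cube times
  its oscillation.\<close>

lemma superlevel_le:
  fixes f :: "real ^ 'n::finite \<Rightarrow> real"
  assumes f: "set_integrable lebesgue (cube a 1) f" and sub: "cube b l \<subseteq> cube a 1"
    and l: "0 < l" and s: "0 < s"
  shows "measure lebesgue {x \<in> cube b l. \<bar>f x - average f (cube b l)\<bar> > s}
    \<le> l ^ CARD('n) * mean_osc f (cube b l) / s"
proof -
  define A where "A = average f (cube b l)"
  let ?E = "{x \<in> cube b l. \<bar>f x - A\<bar> > s}"
  have E: "?E \<in> lmeasurable" by (rule superlevel_lmeasurable[OF f sub])
  have "s * measure lebesgue ?E = (\<integral>x. s * indicator ?E x \<partial>lebesgue)"
    using E by simp
  also have "\<dots> \<le> (\<integral>x. indicator (cube b l) x *\<^sub>R \<bar>f x - A\<bar> \<partial>lebesgue)"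
  proof (rule integral_mono)
    show "integrable lebesgue (\<lambda>x. s * indicator ?E x)"
      using E by (intro integrable_mult_right) (auto simp: fmeasurable_def)
    show "integrable lebesgue (\<lambda>x. indicator (cube b l) x *\<^sub>R \<bar>f x - A\<bar>)"
      using set_integrable_abs[OF set_integrable_cube_diff_const[OF f sub]]
      unfolding set_integrable_def .
  qed (auto simp: indicator_def)
  also have "\<dots> = l ^ CARD('n) * mean_osc f (cube b l)"
    using integral_abs_average[OF l, where f = f and b = b] by (simp add: A_def set_lebesgue_integral_def)
  finally show ?thesis using s by (simp add: A_def field_simps)
qed

section \<open>Counting the bad cubes of one generation\<close>

text \<open>The supremum inside \<open>osc_norm\<close> before the root \<open>1 / p\<close> is
  taken; finite bounds \<open>S\<close> on it drive all later estimates.\<close>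

definition osc_sup :: "real \<Rightarrow> (real ^ 'n) set \<Rightarrow> (real ^ 'n \<Rightarrow> real) \<Rightarrow> ennreal" where
  "osc_sup p Q0 f =
     (SUP t\<in>{0<..}. ennreal (t powr p) *
        (\<Sum>\<^sub>\<infinity>Q\<in>{Q \<in> dyadic_subcubes Q0. mean_osc f Q > t}.
           ennreal (sidelength Q powr (- p) * measure lebesgue Q)))"

text \<open>Take \<open>t = s\<close> in the supremum and keep only the bad cubes of generation
  \<open>k\<close> in the sum; with \<open>d\<close> their side, each contributes the same term
  \<open>d powr (- p) * d ^ CARD('n)\<close>.\<close>

lemma card_bad:
  fixes f :: "real ^ 'n::finite \<Rightarrow> real"
  assumes sup: "osc_sup p (cube a 1) f \<le> ennreal S" and S: "0 \<le> S" and s: "0 < s"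
  shows "real (card (bad f a k s)) * ((1/2) ^ k) ^ CARD('n)
    \<le> S * s powr (- p) * ((1/2) ^ k) powr p"
proof -
  define d :: real where "d = (1/2) ^ k"
  have d: "0 < d" by (simp add: d_def)
  let ?g = "\<lambda>Q :: (real ^ 'n) set. ennreal (sidelength Q powr (- p) * measure lebesgue Q)"
  let ?F = "(\<lambda>b. cube b d) ` bad f a k s"
  define N where "N = real (card (bad f a k s))"
  have fin: "finite ?F" by (simp add: finite_bad)
  \<comment> \<open>Distinct corners give distinct cubes, so the sum over cubes counts every bad
    corner exactly once.\<close>
  have "inj_on (\<lambda>b. cube b d) (bad f a k s)"
    by (rule inj_onI) (rule inj_cube[OF d])
  then have "sum ?g ?F = (\<Sum>b\<in>bad f a k s. ?g (cube b d))"
    by (rule sum.reindex_cong) auto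
  also have "\<dots> = (\<Sum>b\<in>bad f a k s. ennreal (d powr (- p) * d ^ CARD('n)))"
    using d by (simp only: sidelength_cube measure_cube less_imp_le)
  also have "\<dots> = ennreal (N * (d powr (- p) * d ^ CARD('n)))"
    using d by (simp add: N_def ennreal_mult ennreal_of_nat_eq_real_of_nat)
  finally have eq: "sum ?g ?F = ennreal (N * (d powr (- p) * d ^ CARD('n)))" .
  have "sum ?g ?F = infsum ?g ?F"
    using fin by simp
  also have "\<dots> \<le> infsum ?g {Q \<in> dyadic_subcubes (cube a 1). mean_osc f Q > s}"
  proof (rule infsum_mono_neutral)
    \<comment> \<open>Bad cubes are dyadic with oscillation above \<open>s\<close>, so this
      difference of index sets is empty.\<close>
    show "?g Q \<le> 0" if "Q \<in> ?F - {Q \<in> dyadic_subcubes (cube a 1). mean_osc f Q > s}" for Q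
      using that dyadic_corners unfolding d_def bad_def by blast
  qed (auto intro: nonneg_summable_on_complete)
  finally have "ennreal (s powr p) * ennreal (N * (d powr (- p) * d ^ CARD('n)))
      \<le> ennreal (s powr p) * infsum ?g {Q \<in> dyadic_subcubes (cube a 1). mean_osc f Q > s}"
    unfolding eq by (rule mult_left_mono) simp
  also have "\<dots> \<le> osc_sup p (cube a 1) f"
    unfolding osc_sup_def using s by (intro SUP_upper) simp
  also note sup
  finally have "s powr p * (N * (d powr (- p) * d ^ CARD('n))) \<le> S"
    using S d by (simp flip: ennreal_mult add: N_def)
  then have "s powr (- p) * d powr p * (s powr p * (N * (d powr (- p) * d ^ CARD('n))))
      \<le> s powr (- p) * d powr p * S"
    by (intro mult_left_mono) auto
  moreover have "s powr (- p) * d powr p * (s powr p * (N * (d powr (- p) * d ^ CARD('n)))) =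
      (s powr (- p) * s powr p) * (d powr p * d powr (- p)) * (N * d ^ CARD('n))"
    by (simp only: mult_ac)
  moreover have "s powr (- p) * s powr p = 1" "d powr p * d powr (- p) = 1"
    using s d by (simp_all flip: powr_add)
  ultimately have "N * d ^ CARD('n) \<le> s powr (- p) * d powr p * S" by simp
  then show ?thesis unfolding N_def d_def by (simp only: mult_ac)
qed

lemma half_power: "((1/2) ^ k :: real) = 2 powr (- real k)"
  by (simp add: powr_minus_divide powr_realpow power_one_over)

section \<open>Measure of the set of large deviations\<close>

text \<open>A bad cube contributes at most its whole measure; on any other cube Markov's inequality
  leaves at most the fraction \<open>v / u\<close>. The threshold \<open>v\<close> is separate from
  those used along the chain and is sent to 0 later.\<close>

lemma measure_local_deviation_le:
  fixes f :: "real ^ 'n::finite \<Rightarrow> real"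
  assumes f: "set_integrable lebesgue (cube a 1) f" and u: "0 < u" and v: "0 \<le> v"
  shows "measure lebesgue (\<Union>b\<in>corners a m.
      {x \<in> cube b ((1/2) ^ m). \<bar>f x - average f (cube b ((1/2) ^ m))\<bar> > u})
    \<le> real (card (bad f a m v)) * ((1/2) ^ m) ^ CARD('n) + v / u"
proof -
  define d :: real where "d = (1/2) ^ m"
  have d: "0 < d" by (simp add: d_def)
  let ?n = "CARD('n)"
  let ?D = "\<lambda>b. {x \<in> cube b d. \<bar>f x - average f (cube b d)\<bar> > u}"
  have D: "?D b \<in> lmeasurable" if "b \<in> corners a m" for b
    using that unfolding d_def by (intro superlevel_lmeasurable[OF f] corners_subset)
  have one: "measure lebesgue (?D b) \<le> indicator (bad f a m v) b * d ^ ?n + d ^ ?n * v / u"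
    if b: "b \<in> corners a m" for b
  proof (cases "b \<in> bad f a m v")
    case True
    have "measure lebesgue (?D b) \<le> measure lebesgue (cube b d)"
      using D[OF b] by (intro measure_mono_fmeasurable) auto
    also have "\<dots> = d ^ ?n" using d by (simp add: measure_cube)
    finally show ?thesis using True u v d by (simp add: add_increasing2)
  next
    case False
    then have osc: "mean_osc f (cube b d) \<le> v" using b by (simp add: bad_def d_def)
    have "measure lebesgue (?D b) \<le> d ^ ?n * mean_osc f (cube b d) / u"
      using corners_subset[OF b] unfolding d_def by (intro superlevel_le[OF f _ _ u]) auto
    also have "\<dots> \<le> d ^ ?n * v / u"
      using osc u d by (intro divide_right_mono mult_left_mono) auto
    finally show ?thesis using False by simp
  qed
  have sub: "bad f a m v \<subseteq> corners a m" by (auto simp: bad_def)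
  have "measure lebesgue (\<Union>b\<in>corners a m. ?D b) \<le> (\<Sum>b\<in>corners a m. measure lebesgue (?D b))"
    using D by (intro measure_UNION_le) (auto simp: finite_corners)
  also have "\<dots> \<le> (\<Sum>b\<in>corners a m. indicator (bad f a m v) b * d ^ ?n + d ^ ?n * v / u)"
    by (intro sum_mono one)
  also have "\<dots> = (\<Sum>b\<in>corners a m. indicator (bad f a m v) b) * d ^ ?n
      + real (card (corners a m)) * d ^ ?n * (v / u)"
    by (simp add: sum.distrib sum_distrib_right)
  also have "(\<Sum>b\<in>corners a m. indicator (bad f a m v) b) = real (card (bad f a m v))"
  proof -
    have "(\<Sum>b\<in>corners a m. indicator (bad f a m v) b) =
        (\<Sum>b\<in>bad f a m v. indicator (bad f a m v) b :: real)"
      using sub by (intro sum.mono_neutral_right) (auto simp: finite_corners)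
    then show ?thesis by simp
  qed
  also have "real (card (corners a m)) * d ^ ?n * (v / u) \<le> 1 * (v / u)"
  proof (rule mult_right_mono)
    have "real (card (corners a m)) * d ^ ?n \<le> (2 ^ ?n) ^ m * d ^ ?n"
      using of_nat_mono[OF card_corners[of a m], where 'a = real] d
      by (intro mult_right_mono) auto
    also have "\<dots> = ((2 :: real) ^ m * d) ^ ?n"
      by (simp add: power_mult_distrib flip: power_mult)
    also have "(2 :: real) ^ m * d = 1" by (simp add: d_def power_one_over)
    finally show "real (card (corners a m)) * d ^ ?n \<le> 1" by simp
  qed (use u v in auto)
  finally show ?thesis by (simp add: d_def)
qed

text \<open>The budget \<open>t\<close> is split into the drift of the averages down to generation
  \<open>m\<close> and the deviation \<open>u\<close> from the last average. A point exceeding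
  \<open>t\<close> either meets a bad cube of an earlier generation or deviates by more than
  \<open>u\<close> on a cube of generation \<open>m\<close>.\<close>

lemma measure_deviation_le:
  fixes f :: "real ^ 'n::finite \<Rightarrow> real"
  assumes f: "set_integrable lebesgue (cube a 1) f" and u: "0 < u" and v: "0 \<le> v"
    and t: "u + 2 ^ CARD('n) * (\<Sum>k<m. s k) \<le> t"
  shows "measure lebesgue {x \<in> cube a 1. \<bar>f x - average f (cube a 1)\<bar> > t}
    \<le> (\<Sum>k<m. real (card (bad f a k (s k))) * ((1/2) ^ k) ^ CARD('n))
      + (real (card (bad f a m v)) * ((1/2) ^ m) ^ CARD('n) + v / u)"
proof -
  let ?E = "{x \<in> cube a 1. \<bar>f x - average f (cube a 1)\<bar> > t}"
  let ?B = "\<lambda>k. \<Union>b\<in>bad f a k (s k). cube b ((1/2) ^ k)"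
  let ?G = "\<Union>b\<in>corners a m.
      {x \<in> cube b ((1/2) ^ m). \<bar>f x - average f (cube b ((1/2) ^ m))\<bar> > u}"
  have E: "?E \<in> lmeasurable" by (rule superlevel_lmeasurable[OF f order.refl])
  have B: "?B k \<in> lmeasurable" for k
    by (intro fmeasurable.finite_UN) (auto simp: finite_bad)
  then have UB: "(\<Union>k<m. ?B k) \<in> lmeasurable"
    by (rule fmeasurable.finite_UN[OF finite_lessThan])
  have G: "?G \<in> lmeasurable"
    by (intro fmeasurable.finite_UN superlevel_lmeasurable[OF f] corners_subset) (auto simp: finite_corners)
  have sub: "?E \<subseteq> (\<Union>k<m. ?B k) \<union> ?G"
  proof (intro subsetI, rule ccontr)
    fix x assume x: "x \<in> ?E" and nx: "x \<notin> (\<Union>k<m. ?B k) \<union> ?G"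
    from nx have good: "\<And>k b. k < m \<Longrightarrow> b \<in> bad f a k (s k) \<Longrightarrow> x \<notin> cube b ((1/2) ^ k)"
      by auto
    from x have "x \<in> cube a 1" by simp
    from chain_average[OF f this good] obtain b
      where b: "b \<in> corners a m" "x \<in> cube b ((1/2) ^ m)" and
        avg: "\<bar>average f (cube b ((1/2) ^ m)) - average f (cube a 1)\<bar>
          \<le> 2 ^ CARD('n) * (\<Sum>k<m. s k)"
      by blast
    have "\<bar>f x - average f (cube b ((1/2) ^ m))\<bar> \<le> u"
      using nx b by (auto simp: not_less)
    then have "\<bar>f x - average f (cube a 1)\<bar> \<le> t" using avg t by linarith
    with x show False by simp
  qed
  have "measure lebesgue ?E \<le> measure lebesgue ((\<Union>k<m. ?B k) \<union> ?G)"
    using E UB G by (intro measure_mono_fmeasurable[OF sub]) auto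
  also have "\<dots> \<le> measure lebesgue (\<Union>k<m. ?B k) + measure lebesgue ?G"
    using UB G by (intro measure_Un_le) auto
  also have "measure lebesgue (\<Union>k<m. ?B k) \<le> (\<Sum>k<m. measure lebesgue (?B k))"
    using B by (intro measure_UNION_le) auto
  also have "\<dots> \<le> (\<Sum>k<m. real (card (bad f a k (s k))) * ((1/2) ^ k) ^ CARD('n))"
  proof (rule sum_mono)
    fix k
    have "measure lebesgue (?B k) \<le> (\<Sum>b\<in>bad f a k (s k). measure lebesgue (cube b ((1/2) ^ k)))"
      by (intro measure_UNION_le) (auto simp: finite_bad)
    then show "measure lebesgue (?B k) \<le> real (card (bad f a k (s k))) * ((1/2) ^ k) ^ CARD('n)"
      by (simp add: measure_cube)
  qed
  also have "measure lebesgue ?G \<le> real (card (bad f a m v)) * ((1/2) ^ m) ^ CARD('n) + v / u"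
    by (rule measure_local_deviation_le[OF f u v])
  finally show ?thesis by simp
qed

section \<open>Choice of thresholds and the estimate at large levels\<close>

lemma sum_lessThan_add:
  fixes g :: "nat \<Rightarrow> 'a :: comm_monoid_add"
  shows "(\<Sum>k<K + i. g k) = (\<Sum>k<K. g k) + (\<Sum>j<i. g (K + j))"
  by (induction i) (simp_all add: add.assoc)

lemma sum_geometric_le:
  fixes x :: real
  assumes "0 \<le> x" "x < 1"
  shows "(\<Sum>j<i. x ^ j) \<le> 1 / (1 - x)"
  using assms by (simp add: geometric_sum sum_gp_strict divide_right_mono)

text \<open>Thresholds decaying like \<open>2 powr (- j / 2)\<close> use up half of the decay
  exponent in \<open>card_bad\<close>; the other half keeps the measures of the bad cubes
  summable.\<close>

lemma sqrt_half_powr: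
  fixes p :: real
  shows "((2 powr (- 1/2)) ^ j) powr (- p) * ((1/2) ^ j) powr p = ((2 powr (- 1/2)) powr p) ^ j"
  unfolding half_power by (simp add: powr_powr powr_power flip: powr_add) (simp add: field_simps)

text \<open>Stopping at the generation \<open>K\<close> where \<open>w * \<beta> ^ K\<close> is
  about \<open>c1 * t\<close> leaves bad cubes of measure at most a constant times
  \<open>(w / t) powr p * 2 powr (- p * K)\<close>, whose second factor is at most a constant times
  \<open>(w / t) powr (p * p / (n - p))\<close>. The exponents add up to
  \<open>n * p / (n - p)\<close>.\<close>

lemma weak_type_large:
  fixes f :: "real ^ 'n::finite \<Rightarrow> real" and p S t :: real
  defines "n \<equiv> real CARD('n)"
  defines "\<beta> \<equiv> 2 powr ((n - p) / p)" and "r \<equiv> 2 powr (- 1/2)"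
  defines "w \<equiv> S powr (1 / p)" and "c1 \<equiv> (\<beta> - 1) / (8 * 2 ^ CARD('n))"
    and "c2 \<equiv> (1 - r) / (2 * 2 ^ CARD('n))"
  assumes f: "set_integrable lebesgue (cube a 1) f"
    and sup: "osc_sup p (cube a 1) f \<le> ennreal S" and S: "0 < S"
    and p: "0 < p" "p < n" and t: "0 < t" and wt: "w \<le> c1 * t"
  shows "measure lebesgue {x \<in> cube a 1. \<bar>f x - average f (cube a 1)\<bar> > t}
    \<le> 2 powr p * c2 powr (- p) * c1 powr (- (p * p / (n - p))) / (1 - r powr p)
      * (w / t) powr (n * p / (n - p))"
proof -
  let ?n = "CARD('n)"
  let ?E = "{x \<in> cube a 1. \<bar>f x - average f (cube a 1)\<bar> > t}"
  define \<alpha> where "\<alpha> = (n - p) / p"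
  have \<alpha>: "0 < \<alpha>" and \<alpha>p: "\<alpha> * p = n - p" using p by (simp_all add: \<alpha>_def)
  have \<beta>: "1 < \<beta>" using \<alpha> by (simp add: \<beta>_def flip: \<alpha>_def)
  have \<beta>_power: "\<beta> ^ k = 2 powr (\<alpha> * real k)" for k
    by (simp add: \<beta>_def powr_power mult.commute flip: \<alpha>_def)
  have r: "0 < r" "r < 1" by (simp_all add: r_def powr_less_one)
  define \<gamma> where "\<gamma> = r powr p"
  have \<gamma>: "0 < \<gamma>" "\<gamma> < 1" using r p powr_less_mono2[of p r 1] by (simp_all add: \<gamma>_def)
  have c: "0 < c1" "0 < c2" using \<beta> r by (simp_all add: c1_def c2_def)
  have w: "0 < w" and wp: "w powr p = S" using S p by (simp_all add: w_def powr_powr)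

  text \<open>Up to generation \<open>K\<close> the thresholds come from the bound on a single cube, whose
    oscillation is at most \<open>w * \<beta> ^ k\<close> (the factor 2 below makes the count of bad cubes
    strictly less than 1); from \<open>K\<close> on they decay geometrically.\<close>
  obtain K where K: "w * \<beta> ^ K \<le> c1 * t" "c1 * t < w * \<beta> ^ Suc K"
  proof -
    obtain N where N: "c1 * t / w < \<beta> ^ N" using real_arch_pow[OF \<beta>] by blast
    \<comment> \<open>\<open>K\<close> is the predecessor of the first exponent at which
      \<open>w * \<beta> ^ N\<close> exceeds \<open>c1 * t\<close>; by \<open>wt\<close> that
      exponent is not 0.\<close>
    define L where "L = (LEAST N. c1 * t / w < \<beta> ^ N)"
    have L: "c1 * t / w < \<beta> ^ L" unfolding L_def using N by (rule LeastI)
    have "L \<noteq> 0"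
    proof
      assume "L = 0"
      then show False using L wt w by (simp add: pos_divide_less_eq)
    qed
    then obtain K where LK: "L = Suc K" by (metis not0_implies_Suc)
    have "\<not> c1 * t / w < \<beta> ^ K"
      using not_less_Least[of K "\<lambda>N. c1 * t / w < \<beta> ^ N"] LK unfolding L_def by simp
    then show ?thesis
      using that[of K] L w unfolding LK by (simp add: pos_divide_less_eq mult.commute not_less)
  qed

  define s where "s k = (if k < K then 2 * w * \<beta> ^ k else c2 * t * r ^ (k - K))" for k
  \<comment> \<open>The constants \<open>c1\<close> and \<open>c2\<close> are tuned to this budget:
    the growing thresholds cost at most \<open>t / 4\<close>, the decaying ones at most
    \<open>t / 2\<close>, and \<open>t / 4\<close> remains for the deviation from the last
    average.\<close>
  have sum_s: "t / 4 + 2 ^ ?n * (\<Sum>k<K + i. s k) \<le> t" for i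
  proof -
    have "(\<Sum>k<K. s k) = 2 * w * (\<Sum>k<K. \<beta> ^ k)"
      by (simp add: s_def sum_distrib_left)
    also have "\<dots> = 2 * (w * \<beta> ^ K - w) / (\<beta> - 1)"
      using \<beta> by (simp add: geometric_sum right_diff_distrib)
    also have "\<dots> \<le> 2 * (c1 * t) / (\<beta> - 1)"
      using K w \<beta> by (intro divide_right_mono mult_left_mono) auto
    also have "\<dots> = t / (4 * 2 ^ ?n)"
      using \<beta> by (simp add: c1_def)
    finally have 1: "2 ^ ?n * (\<Sum>k<K. s k) \<le> t / 4"
      by (simp add: field_simps)
    have "(\<Sum>j<i. s (K + j)) = c2 * t * (\<Sum>j<i. r ^ j)"
      by (simp add: s_def sum_distrib_left)
    also have "\<dots> \<le> c2 * t * (1 / (1 - r))"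
      using r c t by (intro mult_left_mono sum_geometric_le) auto
    also have "\<dots> = t / (2 * 2 ^ ?n)"
      using r by (simp add: c2_def)
    finally have 2: "2 ^ ?n * (\<Sum>j<i. s (K + j)) \<le> t / 2"
      by (simp add: field_simps)
    from 1 2 show ?thesis by (simp add: sum_lessThan_add distrib_left)
  qed

  have empty: "card (bad f a k (s k)) = 0" if "k < K" for k
  proof -
    define d :: real where "d = (1/2) ^ k"
    have d: "0 < d" by (simp add: d_def)
    have "(\<beta> ^ k) powr (- p) = 2 powr (- (n - p) * k)"
      unfolding \<alpha>p[symmetric] \<beta>_power by (simp add: powr_powr mult_ac)
    moreover have "d powr p = 2 powr (- p * k)" "d ^ ?n = 2 powr (- n * k)"
      by (simp_all add: d_def half_power powr_powr powr_power n_def mult_ac)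
    \<comment> \<open>The base \<open>\<beta>\<close> is chosen for this identity; with the factor 2
      in \<open>s\<close>, the bad cubes then have total measure at most \<open>2 powr (- p)\<close>
      times that of a single cube, which forces their number to be 0.\<close>
    ultimately have key: "(\<beta> ^ k) powr (- p) * d powr p = d ^ ?n"
      by (simp flip: powr_add) (simp add: algebra_simps)
    have "real (card (bad f a k (s k))) * d ^ ?n \<le> S * (2 * w * \<beta> ^ k) powr (- p) * d powr p"
      unfolding d_def using card_bad[OF sup, of "s k" k] S w \<beta> that by (simp add: s_def)
    also have "\<dots> = (S * w powr (- p)) * 2 powr (- p) * ((\<beta> ^ k) powr (- p) * d powr p)"
      using w \<beta> by (simp add: powr_mult mult_ac)
    also have "S * w powr (- p) = 1"
      using w S by (simp flip: wp powr_add)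
    also have "1 * 2 powr (- p) * ((\<beta> ^ k) powr (- p) * d powr p) < 1 * d ^ ?n"
      unfolding key using p d by (intro mult_strict_right_mono) (auto simp: powr_less_one)
    finally have "real (card (bad f a k (s k))) < 1"
      using d by simp
    then show ?thesis by simp
  qed

  \<comment> \<open>\<open>A\<close> bounds the measure of the bad cubes of generation
    \<open>K\<close>, the first that can have any.\<close>
  define A where "A = S * (c2 * t) powr (- p) * ((1/2) ^ K) powr p"
  have tail: "real (card (bad f a (K + j) (s (K + j)))) * ((1/2) ^ (K + j)) ^ ?n \<le> A * \<gamma> ^ j" for j
  proof -
    have "real (card (bad f a (K + j) (s (K + j)))) * ((1/2) ^ (K + j)) ^ ?n
      \<le> S * (c2 * t * r ^ j) powr (- p) * ((1/2) ^ (K + j)) powr p"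
      using card_bad[OF sup, of "s (K + j)" "K + j"] S c t r by (simp add: s_def)
    also have "\<dots> = A * ((r ^ j) powr (- p) * ((1/2) ^ j) powr p)"
      using c t r by (simp add: A_def powr_mult power_add mult_ac)
    also have "(r ^ j) powr (- p) * ((1/2) ^ j) powr p = \<gamma> ^ j"
      unfolding r_def \<gamma>_def by (rule sqrt_half_powr)
    finally show ?thesis .
  qed

  \<comment> \<open>The chain runs to generation \<open>K + i\<close>, where the deviation is tested
    with \<open>u = t / 4\<close> and \<open>v = r ^ (K + i)\<close>; the bracketed terms vanish as
    \<open>i\<close> grows.\<close>
  have bound: "measure lebesgue ?E \<le> A / (1 - \<gamma>) + (S * \<gamma> ^ (K + i) + r ^ (K + i) / (t / 4))" for i
  proof -
    have "measure lebesgue ?E \<le>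
      (\<Sum>k<K + i. real (card (bad f a k (s k))) * ((1/2) ^ k) ^ ?n)
      + (real (card (bad f a (K + i) (r ^ (K + i)))) * ((1/2) ^ (K + i)) ^ ?n + r ^ (K + i) / (t / 4))"
      using t r by (intro measure_deviation_le[OF f _ _ sum_s]) auto
    also have "(\<Sum>k<K + i. real (card (bad f a k (s k))) * ((1/2) ^ k) ^ ?n)
      = (\<Sum>j<i. real (card (bad f a (K + j) (s (K + j)))) * ((1/2) ^ (K + j)) ^ ?n)"
      unfolding sum_lessThan_add by (simp add: empty)
    also have "\<dots> \<le> (\<Sum>j<i. A * \<gamma> ^ j)"
      by (intro sum_mono tail)
    also have "\<dots> = A * (\<Sum>j<i. \<gamma> ^ j)"
      by (simp add: sum_distrib_left)
    also have "\<dots> \<le> A * (1 / (1 - \<gamma>))"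
      using \<gamma> S by (intro mult_left_mono sum_geometric_le) (auto simp: A_def)
    also have "real (card (bad f a (K + i) (r ^ (K + i)))) * ((1/2) ^ (K + i)) ^ ?n
      \<le> S * (r ^ (K + i)) powr (- p) * ((1/2) ^ (K + i)) powr p"
      using card_bad[OF sup, of "r ^ (K + i)" "K + i"] S r by simp
    also have "\<dots> = S * \<gamma> ^ (K + i)"
      unfolding r_def \<gamma>_def mult.assoc sqrt_half_powr ..
    finally show ?thesis by simp
  qed
  have "(\<lambda>i. A / (1 - \<gamma>) + (S * \<gamma> ^ (K + i) + r ^ (K + i) / (t / 4)))
      \<longlonglongrightarrow> A / (1 - \<gamma>) + (S * 0 + 0 / (t / 4))"
    using r \<gamma> t unfolding add.commute[of K]
    by (intro tendsto_intros LIMSEQ_ignore_initial_segment LIMSEQ_power_zero) auto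
  then have "measure lebesgue ?E \<le> A / (1 - \<gamma>) + (S * 0 + 0 / (t / 4))"
    using bound by (intro LIMSEQ_le_const) auto
  then have ME: "measure lebesgue ?E \<le> A / (1 - \<gamma>)" by simp

  \<comment> \<open>The upper estimate in \<open>K\<close> bounds \<open>2 ^ K\<close> from below;
    the factor \<open>2 powr p\<close> pays for the gap between \<open>K\<close> and
    \<open>Suc K\<close>.\<close>
  have "((1/2) ^ K) powr p \<le> 2 powr p * (w / (c1 * t)) powr (p / \<alpha>)"
  proof -
    have "c1 * t / w \<le> 2 powr (\<alpha> * Suc K)"
      using K(2) w unfolding \<beta>_power by (simp add: pos_divide_le_eq mult.commute)
    then have "(c1 * t / w) powr (p / \<alpha>) \<le> (2 powr (\<alpha> * Suc K)) powr (p / \<alpha>)"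
      using c t w p \<alpha> by (intro powr_mono2) auto
    also have "\<dots> = 2 powr (p * Suc K)"
      using \<alpha> by (simp add: powr_powr mult.commute)
    also have "\<dots> = 2 powr p * 2 powr (p * K)"
      by (simp flip: powr_add add: algebra_simps)
    finally have le: "(c1 * t / w) powr (p / \<alpha>) \<le> 2 powr p * 2 powr (p * K)" .
    have 1: "2 powr (p * K) * ((1/2) ^ K) powr p = 1"
      unfolding half_power by (simp add: powr_powr flip: powr_add)
    have "(c1 * t / w) powr (p / \<alpha>) * (w / (c1 * t)) powr (p / \<alpha>) = 1"
      using c t w by (simp flip: powr_mult)
    then have "((1/2) ^ K) powr p =
        (c1 * t / w) powr (p / \<alpha>) * ((w / (c1 * t)) powr (p / \<alpha>) * ((1/2) ^ K) powr p)"
      by (simp only: mult.assoc[symmetric] mult_1_left)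
    also have "\<dots> \<le> 2 powr p * 2 powr (p * K) *
        ((w / (c1 * t)) powr (p / \<alpha>) * ((1/2) ^ K) powr p)"
      using le by (rule mult_right_mono) auto
    also have "\<dots> = (2 powr (p * K) * ((1/2) ^ K) powr p) *
        (2 powr p * (w / (c1 * t)) powr (p / \<alpha>))"
      by (simp only: mult_ac)
    finally show ?thesis unfolding 1 by simp
  qed
  then have "A \<le> S * (c2 * t) powr (- p) * (2 powr p * (w / (c1 * t)) powr (p / \<alpha>))"
    unfolding A_def using S by (intro mult_left_mono) auto
  also have "\<dots> = 2 powr p * c2 powr (- p) * c1 powr (- (p / \<alpha>)) *
      ((w powr p * t powr (- p)) * (w powr (p / \<alpha>) * t powr (- (p / \<alpha>))))"
    using c t w by (simp add: wp powr_mult powr_divide powr_minus_divide mult_ac)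
  also have "(w powr p * t powr (- p)) * (w powr (p / \<alpha>) * t powr (- (p / \<alpha>))) =
      (w / t) powr (p + p / \<alpha>)"
    using w t by (simp add: powr_add powr_divide powr_minus_divide)
  also have "p / \<alpha> = p * p / (n - p)" by (simp add: \<alpha>_def)
  also have "p + p * p / (n - p) = n * p / (n - p)" using p by (simp add: field_simps)
  finally have "A \<le> 2 powr p * c2 powr (- p) * c1 powr (- (p * p / (n - p)))
      * (w / t) powr (n * p / (n - p))" .
  then have "A / (1 - \<gamma>) \<le> 2 powr p * c2 powr (- p) * c1 powr (- (p * p / (n - p)))
      * (w / t) powr (n * p / (n - p)) / (1 - \<gamma>)"
    using \<gamma> by (intro divide_right_mono) auto
  with ME show ?thesis by (simp add: \<gamma>_def)
qed

section \<open>All levels with one constant\<close>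

text \<open>At levels \<open>t < w / c1\<close> the trivial bound 1 on the measure suffices, since
  \<open>t powr q\<close> is then at most a constant times \<open>w powr q\<close>. The constant is
  fixed before \<open>f\<close>, \<open>a\<close>, \<open>S\<close> and \<open>t\<close>.\<close>

lemma weak_type:
  fixes p :: real
  assumes p: "0 < p" "p < real CARD('n::finite)"
    and q: "q = real CARD('n) * p / (real CARD('n) - p)"
  obtains C :: real where "0 < C"
    and "\<And>(f :: real ^ 'n \<Rightarrow> real) a S t. set_integrable lebesgue (cube a 1) f \<Longrightarrow>
      osc_sup p (cube a 1) f \<le> ennreal S \<Longrightarrow> 0 < S \<Longrightarrow> 0 < t \<Longrightarrow>
      t powr q * measure lebesgue {x \<in> cube a 1. \<bar>f x - average f (cube a 1)\<bar> > t}
        \<le> C * S powr (q / p)"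
proof -
  define n where "n = real CARD('n)"
  define c1 :: real where "c1 = (2 powr ((n - p) / p) - 1) / (8 * 2 ^ CARD('n))"
  define c2 :: real where "c2 = (1 - 2 powr (- 1/2)) / (2 * 2 ^ CARD('n))"
  define C1 where "C1 = 2 powr p * c2 powr (- p) * c1 powr (- (p * p / (n - p)))
    / (1 - (2 powr (- 1/2)) powr p)"
  \<comment> \<open>One entry for each regime of \<open>t\<close>; the second also makes
    \<open>C\<close> positive.\<close>
  define C where "C = max C1 (c1 powr (- q))"
  have c1: "0 < c1" using p by (simp add: c1_def n_def)
  have q0: "0 < q" using p by (simp add: q)
  show ?thesis
  proof (rule that[of C])
    show "0 < C" using c1 by (simp add: C_def less_max_iff_disj)
  next
    fix f :: "real ^ 'n \<Rightarrow> real" and a and S t :: real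
    assume f: "set_integrable lebesgue (cube a 1) f"
      and sup: "osc_sup p (cube a 1) f \<le> ennreal S" and S: "0 < S" and t: "0 < t"
    let ?E = "{x \<in> cube a 1. \<bar>f x - average f (cube a 1)\<bar> > t}"
    define w where "w = S powr (1 / p)"
    have w: "0 < w" and wq: "w powr q = S powr (q / p)"
      using S by (simp_all add: w_def powr_powr)
    show "t powr q * measure lebesgue ?E \<le> C * S powr (q / p)"
    proof (cases "w \<le> c1 * t")
      case True
      have "measure lebesgue ?E \<le> C1 * (w / t) powr q"
        using weak_type_large[OF f sup S p(1) _ t] p True
        unfolding C1_def c1_def c2_def w_def n_def q by simp
      then have "t powr q * measure lebesgue ?E \<le> t powr q * (C1 * (w / t) powr q)"
        by (intro mult_left_mono) auto
      also have "\<dots> = C1 * w powr q"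
        using w t by (simp add: powr_divide)
      also have "\<dots> \<le> C * w powr q"
        by (intro mult_right_mono) (auto simp: C_def)
      finally show ?thesis by (simp add: wq)
    next
      case False
      have "measure lebesgue ?E \<le> measure lebesgue (cube a 1)"
        using superlevel_lmeasurable[OF f order.refl] by (intro measure_mono_fmeasurable) auto
      then have "measure lebesgue ?E \<le> 1" by (simp add: measure_cube)
      moreover have "t powr q \<le> (w / c1) powr q"
        using False t q0 c1 by (intro powr_mono2) (auto simp: field_simps)
      ultimately have "t powr q * measure lebesgue ?E \<le> (w / c1) powr q * 1"
        by (intro mult_mono) auto
      also have "\<dots> = c1 powr (- q) * w powr q"
        using w c1 by (simp add: powr_divide powr_minus_divide)
      also have "\<dots> \<le> C * w powr q"
        by (intro mult_right_mono) (auto simp: C_def)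
      finally show ?thesis by (simp add: wq)
    qed
  qed
qed

section \<open>From real inequalities to the extended norms\<close>

lemma ennreal_powr_ennreal: "0 \<le> y \<Longrightarrow> ennreal_powr (ennreal y) r = ennreal (y powr r)"
  by (simp add: ennreal_powr_def)

lemma ennreal_powr_le:
  assumes "x \<le> ennreal y" "0 \<le> y" "0 \<le> r"
  shows "ennreal_powr x r \<le> ennreal (y powr r)"
proof (cases x)
  case (real z)
  with assms show ?thesis
    by (simp add: ennreal_powr_ennreal powr_mono2)
next
  case top
  with assms show ?thesis by (simp add: top_unique)
qed

theorem theorem2p1:
  fixes p p_star :: real
  assumes "1 \<le> p" and "p < real CARD('n::finite)"
    and "p_star = real CARD('n) * p / (real CARD('n) - p)"
  shows "\<exists>C::real. 0 < C \<and>
    (\<forall>(Q0 :: (real ^ 'n) set) (f :: real ^ 'n \<Rightarrow> real).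
       is_cube Q0 \<longrightarrow> measure lebesgue Q0 = 1 \<longrightarrow> set_integrable lebesgue Q0 f \<longrightarrow>
       weak_Lp_norm p_star Q0 (\<lambda>x. f x - average f Q0) \<le> ennreal C * osc_norm p Q0 f)"
proof -
  let ?q = p_star
  have p: "0 < p" using assms by simp
  have q: "0 < ?q" using assms by simp
  obtain C where C: "0 < C" and weak: "\<And>(f :: real ^ 'n \<Rightarrow> real) a S t.
      set_integrable lebesgue (cube a 1) f \<Longrightarrow>
      osc_sup p (cube a 1) f \<le> ennreal S \<Longrightarrow> 0 < S \<Longrightarrow> 0 < t \<Longrightarrow>
      t powr ?q * measure lebesgue {x \<in> cube a 1. \<bar>f x - average f (cube a 1)\<bar> > t}
        \<le> C * S powr (?q / p)"
    by (rule weak_type[OF p assms(2,3)]) blast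
  show ?thesis
  \<comment> \<open>The constant is a root because
    \<open>(C * S powr (?q / p)) powr (1 / ?q)\<close> equals
    \<open>C powr (1 / ?q) * S powr (1 / p)\<close>.\<close>
  proof (intro exI[of _ "C powr (1 / ?q)"] conjI allI impI)
    show "0 < C powr (1 / ?q)" using C by simp
  next
    fix Q0 :: "(real ^ 'n) set" and f :: "real ^ 'n \<Rightarrow> real"
    assume "is_cube Q0" and one: "measure lebesgue Q0 = 1"
      and f: "set_integrable lebesgue Q0 f"
    then obtain a l where "0 < l" and Q: "Q0 = cube a l" unfolding is_cube_def by blast
    with one have "l ^ CARD('n) = 1" by (simp add: measure_cube)
    then have "l = 1" using power_eq_iff_eq_base[of "CARD('n)" l 1] \<open>0 < l\<close> by simp
    then have Q: "Q0 = cube a 1" using Q by simp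
    have norm: "osc_norm p Q0 f = ennreal_powr (osc_sup p Q0 f) (1 / p)"
      by (simp add: osc_norm_def osc_sup_def)
    show "weak_Lp_norm ?q Q0 (\<lambda>x. f x - average f Q0)
        \<le> ennreal (C powr (1 / ?q)) * osc_norm p Q0 f"
    proof (cases "osc_sup p Q0 f")
      case top
      then show ?thesis using C by (simp add: norm ennreal_powr_def ennreal_mult_top)
    next
      case (real S)
      \<comment> \<open>The bound in \<open>weak\<close> must be positive while \<open>S\<close> may
        be 0, so it is applied to \<open>S + inverse (real (Suc j))\<close>; as
        \<open>?q / p\<close> is positive, the power is continuous at 0 as well.\<close>
      have "t powr ?q * measure lebesgue {x \<in> Q0. \<bar>f x - average f Q0\<bar> > t}
          \<le> C * S powr (?q / p)" if t: "0 < t" for t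
      proof (rule LIMSEQ_le_const)
        have "(\<lambda>j. S + inverse (real (Suc j))) \<longlonglongrightarrow> S"
          using LIMSEQ_inverse_real_of_nat_add .
        then show "(\<lambda>j. C * (S + inverse (real (Suc j))) powr (?q / p)) \<longlonglongrightarrow> C * S powr (?q / p)"
          using real(1) p q by (intro tendsto_mult tendsto_powr2 tendsto_const) auto
        show "\<exists>N. \<forall>j\<ge>N. t powr ?q * measure lebesgue {x \<in> Q0. \<bar>f x - average f Q0\<bar> > t}
            \<le> C * (S + inverse (real (Suc j))) powr (?q / p)"
        proof (intro exI allI impI)
          fix j :: nat
          have "osc_sup p Q0 f \<le> ennreal (S + inverse (real (Suc j)))"
            unfolding real(2) by (rule ennreal_leI) simp
          then show "t powr ?q * measure lebesgue {x \<in> Q0. \<bar>f x - average f Q0\<bar> > t}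
              \<le> C * (S + inverse (real (Suc j))) powr (?q / p)"
            using weak[of a f "S + inverse (real (Suc j))" t] f t real(1)
            unfolding Q by (simp add: add_nonneg_pos)
        qed
      qed
      then have "ennreal (t powr ?q) * emeasure lebesgue {x \<in> Q0. \<bar>f x - average f Q0\<bar> > t}
          \<le> ennreal (C * S powr (?q / p))" if "0 < t" for t
        using that superlevel_lmeasurable[OF f[unfolded Q] order.refl] unfolding Q
        by (simp add: emeasure_eq_measure2 ennreal_leI flip: ennreal_mult)
      then have "weak_Lp_norm ?q Q0 (\<lambda>x. f x - average f Q0)
          \<le> ennreal ((C * S powr (?q / p)) powr (1 / ?q))"
        unfolding weak_Lp_norm_def using C q by (intro ennreal_powr_le SUP_least) auto
      also have "\<dots> = ennreal (C powr (1 / ?q)) * osc_norm p Q0 f"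
        using C q real by (simp add: norm ennreal_powr_ennreal powr_mult powr_powr ennreal_mult)
      finally show ?thesis .
    qed
  qed
qed

end
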